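(* Let $f\in\Pi_{d,\bar p}$ be a monic centered polynomial of degree $d\ge2$ with distinct critical points $c_1,\dots,c_p$ and critical values $v_k=f(c_k)$. Then, as formal power series in $\lambda$, $$\varphi_{z,\lambda}(x)-\lambda\,(T_f\varphi_{z,\lambda})(x)=\frac1{z-x}+\sum_{k=1}^p\frac{1}{v_k-x}\,\Phi_k(\lambda,z),$$ where $$\varphi_{z,\lambda}(x)=\sum_{n=0}^\infty\frac{\lambda^n}{(f^n)'(z)}\,\frac1{f^n(z)-x},\qquad \Phi_k(\lambda,z)=\sum_{n=0}^\infty\lambda^{n+1}\frac{\frac{\partial f}{\partial v_k}(f^n(z))}{(f^{n+1})'(z)},$$ for $\lambda$ a complex parameter and $z,x$ complex variables (with $z$ such that $(f^n)'(z)\neq0$ for all $n$, and $x$ not a critical value of $f$ and different from all $f^n(z)$, $n\ge0$).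
   Context: $T_f$ is the linear operator $T_f\psi(x)=\sum_{w:f(w)=x}\frac{\psi(w)}{(f'(w))^2}$ (for $x$ not a critical value of $f$), applied in the variable $x$ and termwise to the formal series in $\lambda$. A monic centered polynomial of degree $d$ is one of the form $z^d+a_1z^{d-2}+\dots+a_{d-1}$; $\Pi_d$ is the space of these. For $f\in\Pi_d$ with distinct critical points $c_1,\dots,c_p$ and multiplicities $\bar p=\{m_1,\dots,m_p\}$, $\Pi_{d,\bar p}$ is the set of all $g\in\Pi_d$ in a small neighborhood of $f$ having the same number $p$ of distinct critical points $c_i(g)$, close to $c_i$ and of multiplicity $m_i$. It is known to be a $p$-dimensional complex manifold with local holomorphic coordinate $V(g)=(v_1(g),\dots,v_p(g))$, $v_i(g)=g(c_i(g))$. $\frac{\partial f}{\partial v_k}(z)$ denotes the partial derivative of $g(z)$ with respect to $v_k(g)$ ($z$ fixed), evaluated at $g=f$. $f^n$ is the $n$-th iterate and $'$ the derivative in $z$. *)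

theory Defs
  imports "HOL-Analysis.Analysis" "HOL-Computational_Algebra.Computational_Algebra"
begin

definition monic_centered :: "nat \<Rightarrow> complex poly \<Rightarrow> bool" where
  "monic_centered d f \<longleftrightarrow> degree f = d \<and> lead_coeff f = 1 \<and> coeff f (d - 1) = 0"

definition critical_points :: "complex poly \<Rightarrow> complex set" where
  "critical_points f = {w. poly (pderiv f) w = 0}"

text \<open>
  The index type \<open>'p\<close> enumerates the \<open>p = CARD('p)\<close> distinct critical points. The multiplicity
  \<open>m\<^sub>i\<close> of \<open>c i\<close> is its order as a zero of \<open>f'\<close>. The set below is the stratum
  \<open>\<Pi>\<^bsub>d,p\<^esub>\<close> through \<open>f\<close>, cut down to the neighbourhood of size \<open>\<epsilon>\<close>.
\<close>

definition stratum ::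
    "nat \<Rightarrow> complex poly \<Rightarrow> ('p::finite \<Rightarrow> complex) \<Rightarrow> real \<Rightarrow> complex poly set" where
  "stratum d f c \<epsilon> = {g. monic_centered d g \<and> (\<forall>i. norm (coeff g i - coeff f i) < \<epsilon>) \<and>
     (\<exists>b :: 'p \<Rightarrow> complex. inj b \<and> range b = critical_points g \<and>
        (\<forall>i. dist (b i) (c i) < \<epsilon> \<and> order (b i) (pderiv g) = order (c i) (pderiv f)))}"

text \<open>For small \<open>\<epsilon>\<close> and \<open>g\<close> in the stratum, exactly one critical point of \<open>g\<close> lies near \<open>c i\<close>.\<close>

definition crit_pt :: "('p::finite \<Rightarrow> complex) \<Rightarrow> real \<Rightarrow> complex poly \<Rightarrow> 'p \<Rightarrow> complex" where
  "crit_pt c \<epsilon> g i = (THE w. w \<in> critical_points g \<and> dist w (c i) < \<epsilon>)"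

definition crit_val :: "('p::finite \<Rightarrow> complex) \<Rightarrow> real \<Rightarrow> complex poly \<Rightarrow> 'p \<Rightarrow> complex" where
  "crit_val c \<epsilon> g i = poly g (crit_pt c \<epsilon> g i)"

text \<open>
  The polynomial of the stratum with prescribed critical values: the inverse of the
  coordinate map \<open>V = (v\<^sub>1, \<dots>, v\<^sub>p)\<close>.
\<close>

definition poly_of_crit_val ::
    "nat \<Rightarrow> complex poly \<Rightarrow> ('p::finite \<Rightarrow> complex) \<Rightarrow> real \<Rightarrow> ('p \<Rightarrow> complex) \<Rightarrow> complex poly" where
  "poly_of_crit_val d f c \<epsilon> = the_inv_into (stratum d f c \<epsilon>) (crit_val c \<epsilon>)"

text \<open>
  The partial derivative of \<open>g(z)\<close> with respect to the coordinate \<open>v\<^sub>k(g)\<close> at \<open>g = f\<close>, i.e. the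
  complex derivative in the \<open>k\<close>-th variable of \<open>g(z)\<close> composed with the inverse of \<open>V\<close>. It is
  taken on every sufficiently small neighbourhood; the value does not depend on the size \<open>\<epsilon>\<close>.
\<close>

definition dfdv ::
    "nat \<Rightarrow> complex poly \<Rightarrow> ('p::finite \<Rightarrow> complex) \<Rightarrow> 'p \<Rightarrow> complex \<Rightarrow> complex" where
  "dfdv d f c k z = (THE D. \<forall>\<^sub>F \<epsilon> in at_right 0.
     ((\<lambda>t. poly (poly_of_crit_val d f c \<epsilon> ((\<lambda>i. poly f (c i))(k := t))) z)
        has_field_derivative D) (at (poly f (c k))))"

definition T_op :: "complex poly \<Rightarrow> (complex \<Rightarrow> complex) \<Rightarrow> complex \<Rightarrow> complex" where
  "T_op f \<psi> x = (\<Sum>w | poly f w = x. \<psi> w / (poly (pderiv f) w)\<^sup>2)"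

definition T_fps :: "complex poly \<Rightarrow> (complex \<Rightarrow> complex fps) \<Rightarrow> complex \<Rightarrow> complex fps" where
  "T_fps f \<Psi> x = Abs_fps (\<lambda>n. T_op f (\<lambda>y. fps_nth (\<Psi> y) n) x)"

text \<open>In the following two series \<open>fps_X\<close> stands for the formal variable \<open>\<lambda>\<close>.\<close>

definition phi_series :: "complex poly \<Rightarrow> complex \<Rightarrow> complex \<Rightarrow> complex fps" where
  "phi_series f z x =
     Abs_fps (\<lambda>n. 1 / deriv (poly f ^^ n) z * (1 / ((poly f ^^ n) z - x)))"

definition Phi_series ::
    "nat \<Rightarrow> complex poly \<Rightarrow> ('p::finite \<Rightarrow> complex) \<Rightarrow> 'p \<Rightarrow> complex \<Rightarrow> complex fps" where
  "Phi_series d f c k z =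
     fps_X * Abs_fps (\<lambda>n. dfdv d f c k ((poly f ^^ n) z) / deriv (poly f ^^ Suc n) z)"

end

theory Submission
  imports Defs
begin

text \<open>
  With \<open>a = f\<^sup>n(z)\<close>, comparing coefficients of \<open>\<lambda>\<^sup>n\<^sup>+\<^sup>1\<close> reduces the claim to
  \<open>1 / (f'(a) (f(a) - x)) - (\<Sum>f(w) = x. 1 / (f'(w)\<^sup>2 (a - w))) = (\<Sum>k. D\<^sub>k(a) / (f'(a) (v\<^sub>k - x)))\<close>
  where \<open>D\<^sub>k = \<partial>f/\<partial>v\<^sub>k\<close>. This holds because \<open>D\<^sub>k\<close> is the Hermite interpolation polynomial: it has degree
  less than \<open>d - 1\<close> and agrees with \<open>\<delta>\<^sub>j\<^sub>k\<close> to order \<open>m\<^sub>j\<close> at \<open>c\<^sub>j\<close>. After clearing denominators, the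
  difference of the two sides is a polynomial in \<open>a\<close> of degree at most \<open>2d - 2\<close> which vanishes on the
  \<open>d\<close> preimages of \<open>x\<close> and, counted with multiplicity, on the \<open>d - 1\<close> critical points.

  To identify \<open>D\<^sub>k\<close>, a polynomial of the stratum is written as
  \<open>s + \<integral>\<^sub>0 d (\<Prod>j. (u - b\<^sub>j)\<^bsup>m\<^sub>j\<^esup>) du\<close>. The map sending \<open>(b, s)\<close> to the critical values and the coefficient
  of \<open>z\<^sup>d\<^sup>-\<^sup>1\<close> has an injective differential, since a tangent vector in its kernel would yield a polynomial
  of degree less than \<open>d - 1\<close> with \<open>d - 1\<close> zeros. The inverse function theorem then gives the local
  coordinates on the stratum, and differentiating the family gives the interpolation property.
\<close>

unbundle no fps_syntax

section \<open>Counting zeros\<close>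

lemma sum_order_eq_degree:
  fixes q :: "complex poly"
  assumes "q \<noteq> 0"
  shows "(\<Sum>a | poly q a = 0. order a q) = degree q"
proof -
  have "degree q = degree (smult (lead_coeff q) (\<Prod>a | poly q a = 0. [:-a, 1:] ^ order a q))"
    by (simp only: complex_poly_decompose)
  also have "\<dots> = (\<Sum>a | poly q a = 0. order a q)"
    using assms by (simp add: degree_prod_sum_eq degree_power_eq)
  finally show ?thesis by simp
qed

text \<open>Over the complex numbers \<open>q\<close> has exactly \<open>degree q\<close> zeros
  counted with multiplicity, and a nonzero \<open>p\<close> would inherit them all. This is the
  uniqueness half of Hermite interpolation.\<close>

lemma poly_eq_0_if_zeros_of_larger_degree:
  fixes p q :: "complex poly"
  assumes dvd: "\<And>a. poly q a = 0 \<Longrightarrow> [:-a, 1:] ^ order a q dvd p" and deg: "degree p < degree q"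
  shows "p = 0"
proof (rule ccontr)
  assume p: "p \<noteq> 0"
  have q: "q \<noteq> 0" using deg by auto
  have le: "order a q \<le> order a p" if "poly q a = 0" for a
    using dvd[OF that] p by (simp add: order_divides)
  have "degree q = (\<Sum>a | poly q a = 0. order a q)"
    by (simp add: sum_order_eq_degree[OF q])
  also have "\<dots> \<le> (\<Sum>a | poly q a = 0. order a p)"
    using le by (intro sum_mono) auto
  also have "\<dots> \<le> (\<Sum>a | poly p a = 0. order a p)"
  proof (intro sum_mono2)
    show "{a. poly q a = 0} \<subseteq> {a. poly p a = 0}"
      using le q p by (fastforce simp: order_root)
  qed (use p in \<open>auto simp: poly_roots_finite\<close>)
  also have "\<dots> \<le> degree p"
    by (rule sum_order_le_degree[OF p])
  finally show False using deg by simp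
qed

text \<open>In characteristic 0, differentiation lowers the order of a zero of a nonzero polynomial
  by exactly one.\<close>

lemma linear_power_dvd_if_dvd_pderiv:
  fixes p :: "complex poly"
  assumes "poly p a = 0" and "[:-a, 1:] ^ (n - 1) dvd pderiv p"
  shows "[:-a, 1:] ^ n dvd p"
proof (cases "p = 0 \<or> n = 0")
  case False
  then have "order a p = Suc (order a (pderiv p))"
    using assms(1) by (simp add: order_pderiv)
  moreover have "pderiv p \<noteq> 0"
    using False assms(1) degree_eq_zeroE[of p] by (fastforce simp: pderiv_eq_0_iff)
  ultimately show ?thesis
    using assms(2) False by (auto simp: order_divides)
qed auto

section \<open>The partial fraction identity\<close>

text \<open>With \<open>N = f - x\<close>, the polynomial \<open>S\<close> interpolates
  \<open>1 / f'\<close> at the preimages of \<open>x\<close>, and \<open>E\<close> interpolates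
  \<open>1 / (f - x)\<close> at the critical points. Together they satisfy the Bezout identity
  \<open>E * N + f' * S = 1\<close>, and division by \<open>f' * N\<close> gives the claim.\<close>

lemma transfer_partial_fractions:
  fixes f :: "complex poly" and c :: "'p::finite \<Rightarrow> complex" and D :: "'p \<Rightarrow> complex poly"
  assumes lead: "lead_coeff f = 1" and crit: "range c = critical_points f"
    and deg: "\<And>k. degree (D k) < degree f - 1"
    and interp: "\<And>j k. [:-c j, 1:] ^ order (c j) (pderiv f) dvd D k - [:if j = k then 1 else 0:]"
    and x: "\<And>k. poly f (c k) \<noteq> x"
    and a: "poly f a \<noteq> x" "poly (pderiv f) a \<noteq> 0"
  shows "1 / (poly (pderiv f) a * (poly f a - x)) -
           (\<Sum>w | poly f w = x. 1 / (a - w) / (poly (pderiv f) w)\<^sup>2) =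
         (\<Sum>k\<in>UNIV. 1 / (poly f (c k) - x) * (poly (D k) a / poly (pderiv f) a))"
proof -
  define N where "N = f - [:x:]"
  define W where "W = {w. poly f w = x}"
  define Nw where "Nw w = (\<Prod>u\<in>W - {w}. [:-u, 1:])" for w
  define S where "S = (\<Sum>w\<in>W. smult (1 / (poly (pderiv f) w)\<^sup>2) (Nw w))"
  define E where "E = (\<Sum>k\<in>UNIV. smult (1 / (poly f (c k) - x)) (D k))"
  \<comment> \<open>A strict bound by \<open>degree f - 1\<close> in the natural numbers forces
    this; \<open>undefined\<close> merely serves as some index.\<close>
  have d: "degree f \<ge> 2" using deg[of undefined] by simp
  have pdN: "pderiv N = pderiv f" by (simp add: N_def pderiv_diff)
  have degN: "degree N = degree f"
    using d unfolding N_def by (subst diff_conv_add_uminus, subst degree_add_eq_left) auto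
  have leadN: "lead_coeff N = 1"
    using d lead unfolding degN by (simp add: N_def coeff_eq_0)
  have N0: "N \<noteq> 0" using leadN by auto
  have degf': "degree (pderiv f) = degree f - 1" by (rule degree_pderiv)
  have f'0: "pderiv f \<noteq> 0" using a by auto
  have W: "W = {w. poly N w = 0}" by (auto simp: W_def N_def)
  have finW: "finite W" using N0 by (simp add: W poly_roots_finite)
  have critN: "poly (pderiv f) w \<noteq> 0" if "w \<in> W" for w
  proof
    assume "poly (pderiv f) w = 0"
    then obtain k where "w = c k" using crit by (auto simp: critical_points_def)
    then show False using x[of k] that by (auto simp: W_def)
  qed
  have rsf: "rsquarefree N"
    unfolding rsquarefree_roots pdN using critN by (auto simp: W)
  have Nprod: "N = (\<Prod>w\<in>W. [:-w, 1:])"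
    using complex_poly_decompose_rsquarefree[OF rsf] leadN by (simp add: W)
  have Nsplit: "N = [:-w, 1:] * Nw w" if "w \<in> W" for w
    unfolding Nprod Nw_def using finW that by (simp add: prod.remove)
  have Nw_self: "poly (Nw w) w = poly (pderiv f) w" if "w \<in> W" for w
    by (subst pdN[symmetric], subst Nsplit[OF that], subst pderiv_mult)
       (simp add: pderiv_pCons)
  have Nw_other: "poly (Nw u) w = 0" if "u \<in> W" "w \<in> W" "u \<noteq> w" for u w
    unfolding Nw_def poly_prod using finW that by (auto intro!: prod_zero)
  have degNw: "degree (Nw w) = degree f - 1" if "w \<in> W" for w
  proof -
    have "Nw w \<noteq> 0" using Nsplit[OF that] N0 by auto
    then have "degree N = 1 + degree (Nw w)"
      by (subst Nsplit[OF that], subst degree_mult_eq) auto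
    then show ?thesis using degN by simp
  qed
  \<comment> \<open>The degree is at most \<open>2d - 2\<close>, while \<open>N * pderiv f\<close>
    has degree \<open>2d - 1\<close>; so it is enough to vanish at the zeros of that product with
    multiplicity.\<close>
  have "E * N + pderiv f * S - 1 = 0"
  proof (rule poly_eq_0_if_zeros_of_larger_degree[where q = "N * pderiv f"])
    have "degree S \<le> degree f - 1"
      unfolding S_def using degNw by (intro degree_sum_le finW) (auto intro!: order.trans[OF degree_smult_le])
    then have 1: "degree (pderiv f * S) \<le> 2 * degree f - 2"
      using degree_mult_le[of "pderiv f" S] degf' by simp
    have "degree E \<le> degree f - 2"
    proof -
      have "degree (D k) \<le> degree f - 2" for k using deg[of k] by simp
      then show ?thesis
        unfolding E_def by (intro degree_sum_le) (auto intro!: order.trans[OF degree_smult_le])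
    qed
    then have 2: "degree (E * N) \<le> 2 * degree f - 2"
      using degree_mult_le[of E N] degN d by simp
    have "degree (E * N + pderiv f * S - 1) \<le> 2 * degree f - 2"
      using 1 2 by (intro degree_diff_le degree_add_le) auto
    moreover have "degree (N * pderiv f) = 2 * degree f - 1"
      using N0 f'0 d by (simp add: degree_mult_eq degN degf')
    ultimately show "degree (E * N + pderiv f * S - 1) < degree (N * pderiv f)"
      using d by simp
  next
    fix u assume "poly (N * pderiv f) u = 0"
    then consider "u \<in> W" | "u \<notin> W" "poly (pderiv f) u = 0" by (auto simp: W)
    then show "[:-u, 1:] ^ order u (N * pderiv f) dvd E * N + pderiv f * S - 1"
    proof cases
      case 1
      have "order u (N * pderiv f) = 1"
        using 1 critN[OF 1] rsquarefree_root_order[OF rsf] N0 f'0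
        by (simp add: order_mult W order_0I)
      \<comment> \<open>Only the summand \<open>w = u\<close> survives, and there
        \<open>Nw u\<close> cancels one of the two factors \<open>f'(u)\<close>.\<close>
      moreover have "poly S u = 1 / poly (pderiv f) u"
      proof -
        have "poly S u = (\<Sum>w\<in>W. if w = u then 1 / poly (pderiv f) u else 0)"
          unfolding S_def poly_sum
          using 1 Nw_self critN Nw_other by (intro sum.cong) (auto simp: power2_eq_square)
        then show ?thesis using 1 finW by simp
      qed
      ultimately show ?thesis
        using 1 critN[OF 1] by (simp add: poly_eq_0_iff_dvd[symmetric] W)
    next
      case 2
      then obtain j where j: "u = c j" using crit by (auto simp: critical_points_def)
      define m where "m = order u (pderiv f)"
      let ?L = "[:-u, 1:] ^ m" and ?e = "1 / (poly f u - x)"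
      have ux: "poly f u - x \<noteq> 0" using x j by auto
      have "order u (N * pderiv f) = m"
        using 2 N0 f'0 by (simp add: order_mult W order_0I m_def)
      moreover have "?L dvd E - [:?e:]"
      proof -
        \<comment> \<open>Spreading the constant over the index set by Kronecker deltas turns
          \<open>E - [:?e:]\<close> into a combination of the interpolation errors of the
          \<open>D k\<close>.\<close>
        have "[:?e:] = (\<Sum>k\<in>UNIV. smult (1 / (poly f (c k) - x)) [:if j = k then 1 else 0:])"
          by (subst sum.mono_neutral_right[of UNIV "{j}"]) (auto simp: j)
        then have "E - [:?e:] = (\<Sum>k\<in>UNIV. smult (1 / (poly f (c k) - x)) (D k - [:if j = k then 1 else 0:]))"
          by (simp only: E_def sum_subtractf[symmetric] smult_diff_right)
        then show ?thesis
          using interp[of j] by (auto simp: j m_def intro!: dvd_sum dvd_smult)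
      qed
      \<comment> \<open>In fact \<open>f - f(u)\<close> vanishes to order \<open>m + 1\<close> at
        \<open>u\<close>; order \<open>m\<close> suffices here.\<close>
      moreover have "?L dvd N - [:poly f u - x:]"
      proof (rule linear_power_dvd_if_dvd_pderiv)
        have "?L dvd pderiv f" by (simp add: m_def order_1)
        then show "[:-u, 1:] ^ (m - 1) dvd pderiv (N - [:poly f u - x:])"
          by (simp add: pderiv_diff pdN) (meson diff_le_self power_le_dvd)
      qed (simp add: N_def)
      moreover have "?L dvd pderiv f" by (simp add: m_def order_1)
      \<comment> \<open>Since \<open>?e\<close> is the inverse of \<open>f(u) - x\<close>, the
        constant 1 is absorbed and each remaining summand is divisible by \<open>?L\<close>.\<close>
      moreover have "E * N + pderiv f * S - 1 =
          (E - [:?e:]) * N + [:?e:] * (N - [:poly f u - x:]) + pderiv f * S"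
      proof -
        have "1 = [:?e:] * [:poly f u - x:]" using ux by (simp add: one_pCons)
        then show ?thesis
          by (metis (no_types, lifting) add_diff_eq diff_add_eq left_diff_distrib right_diff_distrib
              add.commute diff_add_cancel)
      qed
      ultimately show ?thesis by (metis dvd_add dvd_mult dvd_mult2)
    qed
  qed
  then have "poly (E * N + pderiv f * S - 1) a = 0" by simp
  then have one: "poly E a * poly N a + poly (pderiv f) a * poly S a = 1" by simp
  have Na: "poly N a \<noteq> 0" using a by (simp add: N_def)
  have S: "poly S a = poly N a * (\<Sum>w\<in>W. 1 / (a - w) / (poly (pderiv f) w)\<^sup>2)"
  proof -
    have "poly (Nw w) a = poly N a / (a - w)" if "w \<in> W" for w
    proof -
      have "a \<noteq> w" using that a by (auto simp: W_def)
      then show ?thesis by (subst Nsplit[OF that]) (simp add: field_simps)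
    qed
    then show ?thesis
      by (simp add: S_def poly_sum sum_distrib_left mult.commute)
  qed
  have solve: "1 / (q * n) - s = e / q" if "e * n + q * (n * s) = 1" "n \<noteq> 0" "q \<noteq> 0"
    for e n q s :: complex
  proof -
    have e: "e = (1 - q * (n * s)) / n" using that by (simp add: eq_divide_eq algebra_simps)
    show ?thesis unfolding e using that(2,3) by (simp add: field_simps)
  qed
  have "1 / (poly (pderiv f) a * poly N a) -
      (\<Sum>w\<in>W. 1 / (a - w) / (poly (pderiv f) w)\<^sup>2) = poly E a / poly (pderiv f) a"
    by (rule solve[OF one[unfolded S] Na a(2)])
  then show ?thesis
    by (simp add: N_def W_def E_def poly_sum sum_divide_distrib)
qed

section \<open>Parametrized polynomials\<close>

text \<open>The antiderivative vanishing at 0, built formally so that its coefficients depend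
  linearly on those of \<open>p\<close>.\<close>

definition poly_int :: "complex poly \<Rightarrow> complex poly" where
  "poly_int p = (\<Sum>i\<le>degree p. monom (coeff p i / of_nat (Suc i)) (Suc i))"

lemma coeff_poly_int:
  "coeff (poly_int p) n = (if n = 0 then 0 else coeff p (n - 1) / of_nat n)"
proof (cases n)
  case (Suc k)
  have "coeff (poly_int p) n = (\<Sum>i\<le>degree p. if i = k then coeff p k / of_nat n else 0)"
    unfolding poly_int_def coeff_sum by (intro sum.cong) (auto simp: Suc)
  also have "\<dots> = coeff p k / of_nat n"
    by (auto simp: coeff_eq_0)
  finally show ?thesis by (simp add: Suc)
qed (simp add: poly_int_def coeff_sum)

lemma pderiv_poly_int: "pderiv (poly_int p) = p"
  by (simp add: poly_eq_iff coeff_pderiv coeff_poly_int del: of_nat_Suc)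

lemma poly_int_pderiv: "[:coeff p 0:] + poly_int (pderiv p) = p"
  by (auto simp: poly_eq_iff coeff_pderiv coeff_poly_int coeff_pCons split: nat.splits simp del: of_nat_Suc)

text \<open>A bound \<open>N\<close> common to a whole family keeps the range of summation
  independent of the parameter, so the sum can be differentiated term by term.\<close>

lemma poly_eq_sum_atMost:
  fixes p :: "complex poly"
  assumes "degree p \<le> N"
  shows "poly p w = (\<Sum>i\<le>N. coeff p i * w ^ i)"
  by (subst poly_as_sum_of_monoms'[OF assms, symmetric]) (simp only: poly_sum poly_monom)

text \<open>Working with single coefficients avoids choosing a norm on polynomials. The derivative
  is the real one; complex homogeneity is established separately.\<close>

definition coeffs_have_derivative ::
    "('a::real_normed_vector \<Rightarrow> complex poly) \<Rightarrow> ('a \<Rightarrow> complex poly) \<Rightarrow> 'a \<Rightarrow> bool" where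
  "coeffs_have_derivative F F' a \<longleftrightarrow>
     (\<forall>n. ((\<lambda>y. coeff (F y) n) has_derivative (\<lambda>h. coeff (F' h) n)) (at a))"

lemma coeffs_have_derivative_mult:
  assumes "coeffs_have_derivative F F' a" "coeffs_have_derivative G G' a"
  shows "coeffs_have_derivative (\<lambda>y. F y * G y) (\<lambda>h. F a * G' h + F' h * G a) a"
  unfolding coeffs_have_derivative_def coeff_mult coeff_add
  using assms unfolding coeffs_have_derivative_def
  by (auto intro!: derivative_eq_intros simp: sum.distrib)

lemma coeffs_have_derivative_const: "coeffs_have_derivative (\<lambda>y. p) (\<lambda>h. 0) a"
  by (simp add: coeffs_have_derivative_def)

lemma coeffs_have_derivative_power:
  assumes "coeffs_have_derivative F F' a"
  shows "coeffs_have_derivative (\<lambda>y. F y ^ n) (\<lambda>h. smult (of_nat n) (F' h * F a ^ (n - 1))) a"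
proof (induction n)
  case 0
  then show ?case by (simp add: coeffs_have_derivative_const)
next
  case (Suc n)
  have "F a * smult (of_nat n) (F' h * F a ^ (n - 1)) + F' h * F a ^ n =
        smult (of_nat (Suc n)) (F' h * F a ^ (Suc n - 1))" for h
  proof -
    have "smult (of_nat (Suc n)) q = smult (of_nat n) q + q" for q :: "complex poly"
      by (simp only: of_nat_Suc smult_add_left smult_1_left add.commute)
    then show ?thesis by (cases n) (simp_all only: diff_Suc_1 power_Suc mult_smult_right mult_ac
      of_nat_0 smult_0_left add_0 power_0 mult_1_left mult_zero_left mult_1_right mult_zero_right diff_0_eq_0)
  qed
  then show ?case
    using coeffs_have_derivative_mult[OF assms Suc] by simp
qed

lemma coeffs_have_derivative_prod:
  assumes "finite A" "\<And>j. j \<in> A \<Longrightarrow> coeffs_have_derivative (F j) (F' j) a"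
  shows "coeffs_have_derivative (\<lambda>y. \<Prod>j\<in>A. F j y) (\<lambda>h. \<Sum>j\<in>A. F' j h * (\<Prod>i\<in>A - {j}. F i a)) a"
  using assms
proof (induction A rule: finite_induct)
  case empty
  then show ?case by (simp add: coeffs_have_derivative_const)
next
  case (insert k A)
  have "F k a * (\<Sum>j\<in>A. F' j h * (\<Prod>i\<in>A - {j}. F i a)) + F' k h * (\<Prod>i\<in>A. F i a) =
        (\<Sum>j\<in>insert k A. F' j h * (\<Prod>i\<in>insert k A - {j}. F i a))" for h
  proof -
    have "(\<Prod>i\<in>insert k A - {j}. F i a) = F k a * (\<Prod>i\<in>A - {j}. F i a)" if "j \<in> A" for j
    proof -
      have "insert k A - {j} = insert k (A - {j})" using that insert by auto
      then show ?thesis using insert by simp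
    qed
    then have "(\<Sum>j\<in>A. F' j h * (\<Prod>i\<in>insert k A - {j}. F i a)) =
        F k a * (\<Sum>j\<in>A. F' j h * (\<Prod>i\<in>A - {j}. F i a))"
      unfolding sum_distrib_left by (intro sum.cong) (auto simp: mult_ac)
    moreover have "insert k A - {k} = A" using insert by auto
    ultimately show ?thesis using insert by simp
  qed
  then show ?case
    using coeffs_have_derivative_mult[of "F k" "F' k" a, OF _ insert.IH] insert by (simp add: add.commute)
qed

text \<open>Serves to bound the degree of the derivative of a family: coefficients that do not
  depend on the parameter drop out.\<close>

lemma coeff_derivative_eq_0:
  assumes "coeffs_have_derivative F F' a" "\<And>y. coeff (F y) n = r"
  shows "coeff (F' h) n = 0"
proof -
  have "(\<lambda>y. coeff (F y) n) = (\<lambda>y. r)" using assms(2) by auto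
  then have "((\<lambda>y. r) has_derivative (\<lambda>h. coeff (F' h) n)) (at a)"
    using assms(1) unfolding coeffs_have_derivative_def by metis
  then have "(\<lambda>h. coeff (F' h) n) = (\<lambda>h. 0)"
    using has_derivative_unique has_derivative_const by blast
  then show ?thesis by metis
qed

lemma has_derivative_vec_lambda:
  fixes F :: "'n::finite \<Rightarrow> 'a::real_normed_vector \<Rightarrow> 'b::euclidean_space"
  assumes "\<And>j. (F j has_derivative F' j) (at a)"
  shows "((\<lambda>y. \<chi> j. F j y) has_derivative (\<lambda>h. \<chi> j. F' j h)) (at a)"
  unfolding has_derivative_componentwise_within[of "\<lambda>y. \<chi> j. F j y"]
  using assms by (auto simp: Basis_vec_def inner_axis intro!: has_derivative_inner_left)

text \<open>The first summand comes from varying the polynomial, the second from moving the point of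
  evaluation.\<close>

lemma has_derivative_poly_param:
  assumes F: "coeffs_have_derivative F F' a" and deg: "\<And>y. degree (F y) \<le> N"
    and w: "(w has_derivative w') (at a)"
  shows "((\<lambda>y. poly (F y) (w y)) has_derivative
           (\<lambda>h. poly (F' h) (w a) + poly (pderiv (F a)) (w a) * w' h)) (at a)"
proof -
  have "coeff (F' h) n = 0" if "n > N" for n h
    using that le_less_trans[OF deg] by (intro coeff_derivative_eq_0[OF F, where r = 0] coeff_eq_0)
  then have deg': "degree (F' h) \<le> N" for h by (intro degree_le) blast
  have "poly (pderiv (F a)) (w a) = (\<Sum>i\<le>N. of_nat i * coeff (F a) i * w a ^ (i - 1))"
  proof -
    have "F a = (\<Sum>i\<le>N. monom (coeff (F a) i) i)"
      using deg[of a] by (simp add: poly_as_sum_of_monoms')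
    then have "pderiv (F a) = (\<Sum>i\<le>N. pderiv (monom (coeff (F a) i) i))"
      using higher_pderiv_sum[of 1 "\<lambda>i. monom (coeff (F a) i) i" "{..N}"] by simp
    then show ?thesis by (simp add: pderiv_monom poly_sum poly_monom)
  qed
  then have eq: "poly (F' h) (w a) + poly (pderiv (F a)) (w a) * w' h =
      (\<Sum>i\<le>N. coeff (F a) i * (of_nat i * w' h * w a ^ (i - 1)) + coeff (F' h) i * w a ^ i)" for h
    by (simp add: poly_eq_sum_atMost[OF deg'] sum.distrib sum_distrib_left mult_ac)
  have "((\<lambda>y. coeff (F y) i) has_derivative (\<lambda>h. coeff (F' h) i)) (at a)" for i
    using F by (simp add: coeffs_have_derivative_def)
  then show ?thesis
    unfolding eq poly_eq_sum_atMost[OF deg]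
    by (intro has_derivative_sum has_derivative_mult has_derivative_power w)
qed

section \<open>Continuity of polynomial families in a parameter\<close>

definition coeffs_continuous :: "('a::topological_space \<Rightarrow> complex poly) \<Rightarrow> bool" where
  "coeffs_continuous F \<longleftrightarrow> (\<forall>n. continuous_on UNIV (\<lambda>y. coeff (F y) n))"

lemma coeffs_continuous_const: "coeffs_continuous (\<lambda>y. p)"
  by (simp add: coeffs_continuous_def)

lemma coeffs_continuous_mult:
  "coeffs_continuous F \<Longrightarrow> coeffs_continuous G \<Longrightarrow> coeffs_continuous (\<lambda>y. F y * G y)"
  by (auto simp: coeffs_continuous_def coeff_mult intro!: continuous_intros)

lemma coeffs_continuous_power: "coeffs_continuous F \<Longrightarrow> coeffs_continuous (\<lambda>y. F y ^ n)"
  by (induction n) (simp_all add: coeffs_continuous_const coeffs_continuous_mult)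

lemma coeffs_continuous_prod:
  "finite A \<Longrightarrow> (\<And>j. j \<in> A \<Longrightarrow> coeffs_continuous (F j)) \<Longrightarrow> coeffs_continuous (\<lambda>y. \<Prod>j\<in>A. F j y)"
  by (induction A rule: finite_induct) (simp_all add: coeffs_continuous_const coeffs_continuous_mult)

lemma coeffs_continuous_sum:
  "(\<And>j. j \<in> A \<Longrightarrow> coeffs_continuous (F j)) \<Longrightarrow> coeffs_continuous (\<lambda>y. \<Sum>j\<in>A. F j y)"
  by (auto simp: coeffs_continuous_def coeff_sum intro!: continuous_intros)

lemma continuous_on_poly_param:
  assumes "coeffs_continuous F" "\<And>y. degree (F y) \<le> N" "continuous_on UNIV w"
  shows "continuous_on UNIV (\<lambda>y. poly (F y) (w y))"
  unfolding poly_eq_sum_atMost[OF assms(2)]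
  using assms(1,3) by (auto simp: coeffs_continuous_def intro!: continuous_intros)

section \<open>Polynomials with prescribed critical points and multiplicities\<close>

definition crit_cofactor :: "('p::finite \<Rightarrow> nat) \<Rightarrow> complex ^ 'p \<Rightarrow> 'p \<Rightarrow> complex poly" where
  "crit_cofactor m b j = (\<Prod>i\<in>UNIV - {j}. [:-(b $ i), 1:] ^ m i)"

text \<open>The derivative of a monic polynomial of degree \<open>d\<close> with critical points
  \<open>b $ j\<close> of multiplicity \<open>m j\<close>. The multiplicities sum to
  \<open>d - 1\<close>, so the leading factor is \<open>d\<close>.\<close>

definition crit_poly :: "('p::finite \<Rightarrow> nat) \<Rightarrow> complex ^ 'p \<Rightarrow> complex poly" where
  "crit_poly m b = smult (of_nat (Suc (sum m UNIV))) (\<Prod>j\<in>UNIV. [:-(b $ j), 1:] ^ m j)"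

text \<open>The directional derivative of \<open>crit_poly m\<close> at \<open>b\<close> along
  \<beta>, as given by the product rule.\<close>

definition crit_poly_deriv ::
    "('p::finite \<Rightarrow> nat) \<Rightarrow> complex ^ 'p \<Rightarrow> complex ^ 'p \<Rightarrow> complex poly" where
  "crit_poly_deriv m b \<beta> = smult (of_nat (Suc (sum m UNIV)))
     (\<Sum>j\<in>UNIV. smult (of_nat (m j)) ([:-(\<beta> $ j):] * [:-(b $ j), 1:] ^ (m j - 1)) *
        crit_cofactor m b j)"

definition crit_family :: "('p::finite \<Rightarrow> nat) \<Rightarrow> (complex ^ 'p) \<times> complex \<Rightarrow> complex poly" where
  "crit_family m x = [:snd x:] + poly_int (crit_poly m (fst x))"

definition crit_family_deriv ::
    "('p::finite \<Rightarrow> nat) \<Rightarrow> (complex ^ 'p) \<times> complex \<Rightarrow> (complex ^ 'p) \<times> complex \<Rightarrow> complex poly" where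
  "crit_family_deriv m x h = [:snd h:] + poly_int (crit_poly_deriv m (fst x) (fst h))"

text \<open>
  The second component is the coefficient that vanishes exactly for centered polynomials. It makes
  domain and codomain equidimensional, so that the inverse function theorem applies.
\<close>

definition crit_map ::
    "('p::finite \<Rightarrow> nat) \<Rightarrow> (complex ^ 'p) \<times> complex \<Rightarrow> (complex ^ 'p) \<times> complex" where
  "crit_map m x = (\<chi> j. poly (crit_family m x) (fst x $ j), coeff (crit_family m x) (sum m UNIV))"

text \<open>
  The motion of the point \<open>b\<^sub>j\<close> does not contribute to the first component, since \<open>b\<^sub>j\<close> is critical.
\<close>

definition crit_map_deriv ::
    "('p::finite \<Rightarrow> nat) \<Rightarrow> (complex ^ 'p) \<times> complex \<Rightarrow> (complex ^ 'p) \<times> complex \<Rightarrow> (complex ^ 'p) \<times> complex" where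
  "crit_map_deriv m x h =
     (\<chi> j. poly (crit_family_deriv m x h) (fst x $ j), coeff (crit_family_deriv m x h) (sum m UNIV))"

section \<open>Zeros, multiplicities and degrees in the family\<close>

lemma crit_poly_split:
  "crit_poly m b = smult (of_nat (Suc (sum m UNIV))) ([:-(b $ j), 1:] ^ m j * crit_cofactor m b j)"
  unfolding crit_poly_def crit_cofactor_def by (subst prod.remove[of UNIV j]) auto

lemma poly_crit_cofactor_nz:
  assumes "inj (vec_nth b)"
  shows "poly (crit_cofactor m b j) (b $ j) \<noteq> 0"
  using assms by (auto simp: crit_cofactor_def poly_prod inj_eq)

lemma degree_crit_poly: "degree (crit_poly m b) = sum m UNIV"
  unfolding crit_poly_def by (simp add: degree_prod_sum_eq degree_power_eq del: of_nat_Suc)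

lemma lead_coeff_crit_poly: "coeff (crit_poly m b) (sum m UNIV) = of_nat (Suc (sum m UNIV))"
proof -
  have "lead_coeff (crit_poly m b) = of_nat (Suc (sum m UNIV))"
    unfolding crit_poly_def by (simp add: lead_coeff_prod lead_coeff_power del: of_nat_Suc)
  then show ?thesis by (simp add: degree_crit_poly)
qed

lemma poly_crit_poly_eq_0_iff:
  assumes "\<And>j. m j > 0"
  shows "poly (crit_poly m b) w = 0 \<longleftrightarrow> w \<in> range (vec_nth b)"
  using assms by (auto simp: crit_poly_def poly_prod simp del: of_nat_Suc)

lemma order_crit_poly:
  assumes "inj (vec_nth b)"
  shows "order (b $ j) (crit_poly m b) = m j"
proof -
  have "order (b $ j) (crit_poly m b) = order (b $ j) ([:-(b $ j), 1:] ^ m j * crit_cofactor m b j)"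
    unfolding crit_poly_split[of m b j] by (rule order_smult) (simp del: of_nat_Suc)
  also have "\<dots> = m j"
    using poly_crit_cofactor_nz[OF assms, of m j]
    by (subst order_mult) (auto simp: order_power_n_n order_0I)
  finally show ?thesis .
qed

lemma pderiv_crit_family: "pderiv (crit_family m x) = crit_poly m (fst x)"
  by (simp add: crit_family_def pderiv_add pderiv_poly_int pderiv_pCons)

lemma pderiv_crit_family_deriv: "pderiv (crit_family_deriv m x h) = crit_poly_deriv m (fst x) (fst h)"
  by (simp add: crit_family_deriv_def pderiv_add pderiv_poly_int pderiv_pCons)

lemma degree_crit_family_le: "degree (crit_family m x) \<le> Suc (sum m UNIV)"
  by (rule degree_le)
     (auto simp: crit_family_def coeff_poly_int coeff_eq_0 degree_crit_poly coeff_pCons split: nat.splits)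

lemma coeff_crit_family_top: "coeff (crit_family m x) (Suc (sum m UNIV)) = 1"
  by (simp add: crit_family_def coeff_poly_int lead_coeff_crit_poly del: of_nat_Suc)

lemma degree_crit_family: "degree (crit_family m x) = Suc (sum m UNIV)"
  using degree_crit_family_le[of m x] coeff_crit_family_top[of m x]
  by (metis le_degree le_antisym zero_neq_one)

text \<open>The linear factors are affine in the parameter, the product rule handles their product,
  and \<open>poly_int\<close> acts linearly on coefficients.\<close>

lemma coeffs_have_derivative_crit_family:
  "coeffs_have_derivative (crit_family m) (crit_family_deriv m x) x"
proof -
  have lin: "coeffs_have_derivative (\<lambda>y :: (complex ^ 'a) \<times> complex. [:-(fst y $ j), 1:])
      (\<lambda>h. [:-(fst h $ j):]) x" for j
    unfolding coeffs_have_derivative_def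
  proof
    fix n
    have "((\<lambda>y :: (complex ^ 'a) \<times> complex. - (fst y $ j)) has_derivative (\<lambda>h. - (fst h $ j))) (at x)"
      by (intro has_derivative_minus bounded_linear_imp_has_derivative)
         (intro bounded_linear_compose[OF bounded_linear_vec_nth bounded_linear_fst])
    then show "((\<lambda>y :: (complex ^ 'a) \<times> complex. coeff [:-(fst y $ j), 1:] n) has_derivative
        (\<lambda>h. coeff [:-(fst h $ j):] n)) (at x)"
      by (cases n) (auto simp: coeff_pCons split: nat.splits)
  qed
  have "coeffs_have_derivative
      (\<lambda>y :: (complex ^ 'a) \<times> complex. \<Prod>j\<in>UNIV. [:-(fst y $ j), 1:] ^ m j)
      (\<lambda>h. \<Sum>j\<in>UNIV. smult (of_nat (m j)) ([:-(fst h $ j):] * [:-(fst x $ j), 1:] ^ (m j - 1)) *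
        crit_cofactor m (fst x) j) x"
    unfolding crit_cofactor_def
    by (rule coeffs_have_derivative_prod) (intro finite coeffs_have_derivative_power lin)+
  then have cp: "((\<lambda>y. coeff (crit_poly m (fst y)) n) has_derivative
      (\<lambda>h. coeff (crit_poly_deriv m (fst x) (fst h)) n)) (at x)" for n
    unfolding coeffs_have_derivative_def crit_poly_def crit_poly_deriv_def coeff_smult
    by (intro has_derivative_mult_right) auto
  show ?thesis
    unfolding coeffs_have_derivative_def
  proof
    fix n
    have "((\<lambda>y :: (complex ^ 'a) \<times> complex. coeff [:snd y:] n) has_derivative (\<lambda>h. coeff [:snd h:] n)) (at x)"
      by (cases n) (auto intro!: derivative_eq_intros)
    moreover have "((\<lambda>y. coeff (poly_int (crit_poly m (fst y))) n) has_derivative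
        (\<lambda>h. coeff (poly_int (crit_poly_deriv m (fst x) (fst h))) n)) (at x)"
      using cp[of "n - 1"] by (cases n)
        (auto simp: coeff_poly_int divide_inverse simp del: of_nat_Suc intro!: has_derivative_mult_left)
    ultimately show "((\<lambda>y. coeff (crit_family m y) n) has_derivative (\<lambda>h. coeff (crit_family_deriv m x h) n)) (at x)"
      unfolding crit_family_def crit_family_deriv_def coeff_add by (rule has_derivative_add)
  qed
qed

text \<open>All members of the family are monic of the same degree, so the leading coefficient
  disappears on differentiation.\<close>

lemma degree_crit_family_deriv_le: "degree (crit_family_deriv m x h) \<le> sum m UNIV"
proof (rule degree_le, intro allI impI)
  fix n assume n: "n > sum m UNIV"
  have "coeff (crit_family m y) n = (if n = Suc (sum m UNIV) then 1 else 0)" for y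
    using n by (auto simp: coeff_crit_family_top coeff_eq_0 degree_crit_family)
  then show "coeff (crit_family_deriv m x h) n = 0"
    by (rule coeff_derivative_eq_0[OF coeffs_have_derivative_crit_family])
qed

lemma has_derivative_crit_map:
  assumes "\<And>j. m j > 0"
  shows "(crit_map m has_derivative crit_map_deriv m x) (at x)"
proof -
  have "((\<lambda>y. poly (crit_family m y) (fst y $ j)) has_derivative
      (\<lambda>h. poly (crit_family_deriv m x h) (fst x $ j))) (at x)" for j
  proof -
    have "((\<lambda>y :: (complex ^ 'a) \<times> complex. fst y $ j) has_derivative (\<lambda>h. fst h $ j)) (at x)"
      by (intro bounded_linear_imp_has_derivative)
         (intro bounded_linear_compose[OF bounded_linear_vec_nth bounded_linear_fst])
    from has_derivative_poly_param[OF coeffs_have_derivative_crit_family[of m] degree_crit_family_le this]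
    show ?thesis
      using poly_crit_poly_eq_0_iff[of m "fst x" "fst x $ j"] assms by (simp add: pderiv_crit_family)
  qed
  then have "((\<lambda>y. \<chi> j. poly (crit_family m y) (fst y $ j)) has_derivative
      (\<lambda>h. \<chi> j. poly (crit_family_deriv m x h) (fst x $ j))) (at x)"
    by (rule has_derivative_vec_lambda)
  moreover have "((\<lambda>y. coeff (crit_family m y) n) has_derivative (\<lambda>h. coeff (crit_family_deriv m x h) n)) (at x)" for n
    using coeffs_have_derivative_crit_family[of m x] by (simp add: coeffs_have_derivative_def)
  ultimately show ?thesis
    unfolding crit_map_def crit_map_deriv_def by (intro has_derivative_Pair)
qed

section \<open>Continuity of the differential in the base point\<close>

lemma coeffs_continuous_crit_family_deriv: "coeffs_continuous (\<lambda>x. crit_family_deriv m x h)"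
proof -
  have lin: "coeffs_continuous (\<lambda>x :: (complex ^ 'a) \<times> complex. [:-(fst x $ j), 1:])" for j
    unfolding coeffs_continuous_def
  proof
    fix n
    show "continuous_on UNIV (\<lambda>x :: (complex ^ 'a) \<times> complex. coeff [:-(fst x $ j), 1:] n)"
      by (cases n) (auto intro!: continuous_intros)
  qed
  have "coeffs_continuous (\<lambda>x :: (complex ^ 'a) \<times> complex. crit_poly_deriv m (fst x) (fst h))"
  proof -
    \<comment> \<open>Scalar factors become constant polynomials, so that the closure rules for sums
      and products apply.\<close>
    have "(\<lambda>x. crit_poly_deriv m (fst x) (fst h)) = (\<lambda>x :: (complex ^ 'a) \<times> complex. [:of_nat (Suc (sum m UNIV)):] *
       (\<Sum>j\<in>UNIV. [:of_nat (m j):] * ([:-(fst h $ j):] * [:-(fst x $ j), 1:] ^ (m j - 1)) *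
        crit_cofactor m (fst x) j))"
      by (simp add: crit_poly_deriv_def mult.commute)
    then show ?thesis
      unfolding crit_cofactor_def
      by (simp only:)
         (intro coeffs_continuous_mult coeffs_continuous_sum coeffs_continuous_prod
           coeffs_continuous_power coeffs_continuous_const lin finite_Diff finite)
  qed
  then have "continuous_on UNIV
      (\<lambda>x :: (complex ^ 'a) \<times> complex. coeff (poly_int (crit_poly_deriv m (fst x) (fst h))) n)" for n
    by (cases n) (auto simp: coeffs_continuous_def coeff_poly_int simp del: of_nat_Suc intro!: continuous_intros)
  then show ?thesis
    by (auto simp: coeffs_continuous_def crit_family_deriv_def intro!: continuous_intros)
qed

text \<open>Continuity for each fixed direction \<open>h\<close>; in finite dimension this yields
  continuity of the differential as an operator, as the inverse function theorem requires.\<close>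

lemma continuous_on_crit_map_deriv: "continuous_on UNIV (\<lambda>x. crit_map_deriv m x h)"
  unfolding crit_map_deriv_def
  using coeffs_continuous_crit_family_deriv[of m h]
  by (intro continuous_on_Pair continuous_on_vec_lambda
        continuous_on_poly_param[OF _ degree_crit_family_deriv_le] continuous_intros)
     (auto simp: coeffs_continuous_def)

text \<open>Complex homogeneity, which upgrades a real derivative along a coordinate line to a
  complex one.\<close>

lemma crit_family_deriv_scale:
  "crit_family_deriv m x (r *s \<beta>, r * \<sigma>) = smult r (crit_family_deriv m x (\<beta>, \<sigma>))"
proof -
  have "crit_poly_deriv m b (r *s \<beta>) = smult r (crit_poly_deriv m b \<beta>)" for b
    by (auto simp: crit_poly_deriv_def poly_eq_iff coeff_sum sum_distrib_left mult_ac sum_negf intro!: sum.cong)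
  then show ?thesis
    by (auto simp: crit_family_deriv_def poly_eq_iff coeff_poly_int coeff_pCons algebra_simps split: nat.splits)
qed

lemma crit_map_deriv_scale:
  "crit_map_deriv m x (r *s \<beta>, r * \<sigma>) =
     (r *s fst (crit_map_deriv m x (\<beta>, \<sigma>)), r * snd (crit_map_deriv m x (\<beta>, \<sigma>)))"
  by (simp add: crit_map_deriv_def crit_family_deriv_scale vec_eq_iff)

text \<open>Moving a zero of order \<open>m j\<close> leaves order at least \<open>m j - 1\<close>
  in the derivative of \<open>crit_poly\<close>, and integration gains one. Tangent polynomials are
  thus constant up to order \<open>m j\<close> at each critical point.\<close>

lemma crit_family_deriv_interpolates:
  assumes "\<And>j. m j > 0"
  shows "[:-(fst x $ j), 1:] ^ m j dvd
    crit_family_deriv m x h - [:poly (crit_family_deriv m x h) (fst x $ j):]"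
proof (rule linear_power_dvd_if_dvd_pderiv)
  have "[:-(fst x $ j), 1:] ^ (m j - 1) dvd crit_cofactor m (fst x) i" if "i \<noteq> j" for i
  proof -
    have "[:-(fst x $ j), 1:] ^ m j dvd crit_cofactor m (fst x) i"
      unfolding crit_cofactor_def using that by (intro dvd_prodI) auto
    then show ?thesis by (meson diff_le_self power_le_dvd)
  qed
  then have "[:-(fst x $ j), 1:] ^ (m j - 1) dvd
      smult (of_nat (m i)) ([:-(\<beta> $ i):] * [:-(fst x $ i), 1:] ^ (m i - 1)) * crit_cofactor m (fst x) i" for i \<beta>
    by (cases "i = j") (auto intro: dvd_mult dvd_mult2 dvd_smult)
  then have "[:-(fst x $ j), 1:] ^ (m j - 1) dvd crit_poly_deriv m (fst x) (fst h)"
    unfolding crit_poly_deriv_def by (intro dvd_smult dvd_sum)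
  then show "[:-(fst x $ j), 1:] ^ (m j - 1) dvd
      pderiv (crit_family_deriv m x h - [:poly (crit_family_deriv m x h) (fst x $ j):])"
    by (simp add: pderiv_diff pderiv_crit_family_deriv pderiv_pCons)
qed simp

text \<open>The second component is the coefficient of the highest index that can occur; positivity
  of the sum covers the zero polynomial.\<close>

lemma degree_crit_family_deriv_less:
  assumes "sum m UNIV > 0" and "snd (crit_map_deriv m x h) = 0"
  shows "degree (crit_family_deriv m x h) < sum m UNIV"
  using assms degree_crit_family_deriv_le[of m x h]
  by (metis crit_map_deriv_def degree_0 le_neq_implies_less leading_coeff_0_iff snd_conv)

lemma crit_map_deriv_kernel:
  fixes x :: "(complex ^ 'p::finite) \<times> complex"
  assumes m: "\<And>j. m j > 0" and inj: "inj (vec_nth (fst x))" and ker: "crit_map_deriv m x h = 0"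
  shows "h = 0"
proof -
  let ?D = "crit_family_deriv m x h"
  have M: "sum m UNIV > 0" using m by (simp add: sum_pos)
  \<comment> \<open>Its values at the critical points are 0, so it vanishes there to order
    \<open>m j\<close>; these are more zeros than its degree allows.\<close>
  have "?D = 0"
  proof (rule poly_eq_0_if_zeros_of_larger_degree[where q = "crit_poly m (fst x)"])
    show "degree ?D < degree (crit_poly m (fst x))"
      using degree_crit_family_deriv_less[OF M, of x h] ker by (simp add: degree_crit_poly)
    fix a assume "poly (crit_poly m (fst x)) a = 0"
    then obtain j where j: "a = fst x $ j" using poly_crit_poly_eq_0_iff[of m] m by auto
    have "poly ?D (fst x $ j) = 0"
      using ker by (simp add: crit_map_deriv_def vec_eq_iff prod_eq_iff)
    then show "[:-a, 1:] ^ order a (crit_poly m (fst x)) dvd ?D"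
      using crit_family_deriv_interpolates[of m x j h, OF m] order_crit_poly[OF inj, of j m] by (simp add: j)
  qed
  then have "coeff ?D 0 = 0" "pderiv ?D = 0" by auto
  then have snd: "snd h = 0" and cp: "crit_poly_deriv m (fst x) (fst h) = 0"
    by (auto simp: pderiv_crit_family_deriv) (simp add: crit_family_deriv_def coeff_poly_int)
  \<comment> \<open>In the vanishing sum every summand other than \<open>T j\<close> is divisible by
    the full power \<open>m j\<close> at \<open>b $ j\<close>. If \<open>fst h $ j\<close> were
    nonzero, \<open>T j\<close> would have order only \<open>m j - 1\<close> there.\<close>
  have "fst h $ j = 0" for j
  proof (rule ccontr)
    assume nz: "fst h $ j \<noteq> 0"
    define b where "b = fst x"
    define T where "T i = smult (of_nat (m i)) ([:-(fst h $ i):] * [:-(b $ i), 1:] ^ (m i - 1)) * crit_cofactor m b i" for i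
    have "(\<Sum>i\<in>UNIV. T i) = 0"
      using cp unfolding crit_poly_deriv_def T_def b_def by (simp del: of_nat_Suc)
    then have "T j = - (\<Sum>i\<in>UNIV - {j}. T i)"
      by (subst (asm) sum.remove[of UNIV j]) (auto simp: eq_neg_iff_add_eq_0)
    moreover have "[:-(b $ j), 1:] ^ m j dvd T i" if "i \<noteq> j" for i
      unfolding T_def crit_cofactor_def using that by (intro dvd_mult dvd_prodI) auto
    ultimately have dvd: "[:-(b $ j), 1:] ^ m j dvd T j"
      by (auto intro!: dvd_sum)
    have cf: "poly (crit_cofactor m b j) (b $ j) \<noteq> 0"
      using poly_crit_cofactor_nz inj unfolding b_def by blast
    have T: "T j = smult (of_nat (m j) * - (fst h $ j)) ([:-(b $ j), 1:] ^ (m j - 1) * crit_cofactor m b j)"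
      by (simp add: T_def)
    have "order (b $ j) (T j) = m j - 1"
      unfolding T using m[of j] nz cf
      by (subst order_smult, simp, subst order_mult) (auto simp: order_power_n_n order_0I)
    moreover have "T j \<noteq> 0"
      unfolding T using m[of j] nz cf by auto
    ultimately show False using dvd m[of j] by (simp add: order_divides)
  qed
  then show ?thesis using snd by (simp add: prod_eq_iff vec_eq_iff)
qed

lemma crit_map_local_inverse:
  fixes x\<^sub>0 :: "(complex ^ 'p::finite) \<times> complex"
  assumes m: "\<And>j. m j > 0" and inj: "inj (vec_nth (fst x\<^sub>0))"
  obtains U V G where "open U" "x\<^sub>0 \<in> U" "open V" "crit_map m x\<^sub>0 \<in> V"
    "homeomorphism U V (crit_map m) G" "bij (crit_map_deriv m x\<^sub>0)"
    "(G has_derivative inv (crit_map_deriv m x\<^sub>0)) (at (crit_map m x\<^sub>0))"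
proof -
  have bl: "bounded_linear (crit_map_deriv m x)" for x
    using has_derivative_crit_map[of m, OF m] by (rule has_derivative_bounded_linear)
  have app [simp]: "blinfun_apply (Blinfun (crit_map_deriv m x)) = crit_map_deriv m x" for x
    by (rule bounded_linear_Blinfun_apply[OF bl])
  have "inj (crit_map_deriv m x\<^sub>0)"
    using crit_map_deriv_kernel[of m, OF m inj] bl[of x\<^sub>0]
    by (simp add: linear_injective_0 bounded_linear.linear)
  \<comment> \<open>The inverse function theorem asks for a left inverse of the differential, which
    injectivity provides.\<close>
  then obtain L where L: "linear L" "L \<circ> crit_map_deriv m x\<^sub>0 = id"
    using linear_injective_left_inverse[of "crit_map_deriv m x\<^sub>0"] bl[of x\<^sub>0]
    by (auto simp: bounded_linear.linear)
  have linv: "Blinfun L o\<^sub>L Blinfun (crit_map_deriv m x\<^sub>0) = id_blinfun"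
    using L by (intro blinfun_eqI)
      (simp add: bounded_linear_Blinfun_apply linear_conv_bounded_linear[symmetric] pointfree_idE)
  have cont: "continuous_on UNIV (\<lambda>x. Blinfun (crit_map_deriv m x))"
    by (rule continuous_on_blinfun_componentwise) (simp add: continuous_on_crit_map_deriv)
  have der: "(crit_map m has_derivative blinfun_apply (Blinfun (crit_map_deriv m x))) (at x)" for x
    using has_derivative_crit_map[of m, OF m] by simp
  obtain U V G G' where *: "open U" "x\<^sub>0 \<in> U" "open V" "crit_map m x\<^sub>0 \<in> V"
    "homeomorphism U V (crit_map m) G"
    "\<And>y. y \<in> V \<Longrightarrow> (G has_derivative G' y) (at y)"
    "\<And>y. y \<in> V \<Longrightarrow> G' y = inv (blinfun_apply (Blinfun (crit_map_deriv m (G y))))"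
    "\<And>y. y \<in> V \<Longrightarrow> bij (blinfun_apply (Blinfun (crit_map_deriv m (G y))))"
    by (rule inverse_function_theorem[OF open_UNIV der cont UNIV_I linv]) blast
  \<comment> \<open>The theorem describes the derivative of \<open>G\<close> through the base point
    \<open>G y\<close>; for the chosen \<open>y\<close> this point is
    \<open>x\<^sub>0\<close>.\<close>
  have "G (crit_map m x\<^sub>0) = x\<^sub>0"
    using * by (auto simp: homeomorphism_def)
  then show thesis
    using that[of U V G] *(1-5) *(6-8)[of "crit_map m x\<^sub>0"] by simp
qed

section \<open>Local coordinates on the stratum\<close>

text \<open>The derivative factors into its linear factors over the complex numbers, and integrating
  it recovers \<open>g\<close> up to its constant term.\<close>

lemma monic_eq_crit_family:
  fixes g :: "complex poly" and b :: "'p::finite \<Rightarrow> complex"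
  assumes lead: "lead_coeff g = 1" and deg: "degree g \<ge> 1" and "inj b" and crit: "range b = critical_points g"
    and ord: "\<And>j. order (b j) (pderiv g) = m j"
  shows "degree g = Suc (sum m UNIV)" and "g = crit_family m (\<chi> j. b j, coeff g 0)"
proof -
  have nz: "pderiv g \<noteq> 0" using deg by (simp add: pderiv_eq_0_iff)
  have roots: "{a. poly (pderiv g) a = 0} = b ` UNIV"
    using crit by (simp add: critical_points_def)
  have "sum m UNIV = (\<Sum>a | poly (pderiv g) a = 0. order a (pderiv g))"
    unfolding roots using \<open>inj b\<close> ord by (simp add: sum.reindex)
  then have M: "sum m UNIV = degree g - 1"
    by (simp add: sum_order_eq_degree[OF nz] degree_pderiv)
  then show d: "degree g = Suc (sum m UNIV)" using deg by simp
  have "lead_coeff (pderiv g) = of_nat (Suc (sum m UNIV))"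
    using lead d by (simp add: degree_pderiv coeff_pderiv del: of_nat_Suc)
  then have "pderiv g = smult (of_nat (Suc (sum m UNIV))) (\<Prod>a\<in>b ` UNIV. [:-a, 1:] ^ order a (pderiv g))"
    using complex_poly_decompose[of "pderiv g"] roots by metis
  also have "\<dots> = crit_poly m (\<chi> j. b j)"
    using \<open>inj b\<close> ord by (simp add: crit_poly_def prod.reindex)
  finally show "g = crit_family m (\<chi> j. b j, coeff g 0)"
    using poly_int_pderiv[of g] by (simp add: crit_family_def)
qed

lemma crit_family_in_stratum:
  fixes x :: "(complex ^ 'p::finite) \<times> complex"
  assumes m: "\<And>j. m j > 0" and ordf: "\<And>j. order (c j) (pderiv f) = m j"
    and "inj (vec_nth (fst x))" and "snd (crit_map m x) = 0"
    and "\<And>i. norm (coeff (crit_family m x) i - coeff f i) < \<epsilon>"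
    and "\<And>j. dist (fst x $ j) (c j) < \<epsilon>"
  shows "crit_family m x \<in> stratum (Suc (sum m UNIV)) f c \<epsilon>"
proof -
  have "monic_centered (Suc (sum m UNIV)) (crit_family m x)"
    using assms(4) by (simp add: monic_centered_def degree_crit_family coeff_crit_family_top crit_map_def)
  moreover have "range (vec_nth (fst x)) = critical_points (crit_family m x)"
    using poly_crit_poly_eq_0_iff[of m, OF m] by (auto simp: critical_points_def pderiv_crit_family)
  ultimately show ?thesis
    unfolding stratum_def using assms order_crit_poly[OF assms(3), of _ m]
    by (auto simp: pderiv_crit_family intro!: exI[of _ "vec_nth (fst x)"])
qed

text \<open>The discs of radius \<epsilon> around the \<open>c i\<close> are disjoint, so each
  contains exactly one critical point of \<open>g\<close>.\<close>

lemma crit_pt_eq: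
  assumes sep: "\<And>i j. i \<noteq> j \<Longrightarrow> 2 * \<epsilon> \<le> dist (c i) (c j)"
    and "range b = critical_points g" and "\<And>i. dist (b i) (c i) < \<epsilon>"
  shows "crit_pt c \<epsilon> g i = b i"
  unfolding crit_pt_def
proof (rule the_equality)
  show "b i \<in> critical_points g \<and> dist (b i) (c i) < \<epsilon>" using assms by auto
  fix w assume w: "w \<in> critical_points g \<and> dist w (c i) < \<epsilon>"
  then obtain j where j: "w = b j" using assms(2) by auto
  have "dist (c i) (c j) < 2 * \<epsilon>"
    using w j assms(3)[of j] dist_triangle2[of "c i" "c j" w] by (simp add: dist_commute)
  then have "i = j" using sep[of i j] by force
  then show "w = b i" using j by simp
qed

text \<open>Places the parameters of \<open>g\<close> near those of \<open>f\<close> and expresses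
  its critical values through \<open>crit_map\<close>, so that injectivity of
  \<open>crit_map m\<close> near \<open>f\<close> transfers to the stratum. Closeness of the
  constant terms is the coefficient condition at index 0.\<close>

lemma stratum_param:
  fixes c :: "'p::finite \<Rightarrow> complex"
  assumes "d \<ge> 1" and ordf: "\<And>j. order (c j) (pderiv f) = m j"
    and sep: "\<And>i j. i \<noteq> j \<Longrightarrow> 2 * \<epsilon> \<le> dist (c i) (c j)"
    and g: "g \<in> stratum d f c \<epsilon>"
  obtains x where "g = crit_family m x" "\<And>j. dist (fst x $ j) (c j) < \<epsilon>"
    "dist (snd x) (coeff f 0) < \<epsilon>" "crit_map m x = (\<chi> j. crit_val c \<epsilon> g j, 0)"
proof -
  obtain b :: "'p \<Rightarrow> complex" where b: "inj b" "range b = critical_points g"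
    "\<And>i. dist (b i) (c i) < \<epsilon>" "\<And>i. order (b i) (pderiv g) = m i"
    using g ordf unfolding stratum_def by auto
  have mc: "degree g = d" "lead_coeff g = 1" "coeff g (d - 1) = 0" and close: "\<And>i. norm (coeff g i - coeff f i) < \<epsilon>"
    using g unfolding stratum_def monic_centered_def by auto
  let ?x = "(\<chi> j. b j, coeff g 0)"
  have d: "d = Suc (sum m UNIV)" and gx: "g = crit_family m ?x"
    using monic_eq_crit_family[of g b m, OF mc(2)] mc(1) \<open>d \<ge> 1\<close> b by auto
  have "crit_val c \<epsilon> g j = poly g (b j)" for j
    unfolding crit_val_def using crit_pt_eq[OF sep b(2,3), of j] by simp
  then have "crit_map m ?x = (\<chi> j. crit_val c \<epsilon> g j, 0)"
    using mc(3) unfolding crit_map_def gx[symmetric] by (simp add: d)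
  then show thesis
    using that[of ?x] gx b(3) close[of 0] by (simp add: dist_norm)
qed

text \<open>The distance is at most the sum of the \<open>p + 1\<close> coordinate
  distances.\<close>

lemma dist_pair_vec_less:
  fixes x y :: "(complex ^ 'p::finite) \<times> complex"
  assumes "\<And>j. dist (fst x $ j) (fst y $ j) < e / (real CARD('p) + 1)"
    and "dist (snd x) (snd y) < e / (real CARD('p) + 1)"
  shows "dist x y < e"
proof -
  let ?r = "e / (real CARD('p) + 1)"
  have "dist x y \<le> dist (fst x) (fst y) + dist (snd x) (snd y)"
    unfolding dist_prod_def by (rule sqrt_sum_squares_le_sum) auto
  also have "dist (fst x) (fst y) \<le> (\<Sum>j\<in>UNIV. dist (fst x $ j) (fst y $ j))"
    unfolding dist_vec_def by (rule L2_set_le_sum) auto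
  also have "\<dots> \<le> of_nat CARD('p) * ?r"
    using assms(1) by (intro sum_bounded_above) (auto intro: less_imp_le)
  also have "of_nat CARD('p) * ?r + dist (snd x) (snd y) < of_nat CARD('p) * ?r + ?r"
    using assms(2) by simp
  also have "\<dots> = e"
  proof -
    have "real CARD('p) + 1 \<noteq> 0" by linarith
    moreover have "of_nat CARD('p) * ?r + ?r = (real CARD('p) + 1) * ?r"
      by (simp only: distrib_right mult_1_left)
    ultimately show ?thesis by simp
  qed
  finally show ?thesis by simp
qed

text \<open>The polynomial \<open>D\<close> is the tangent vector to the stratum along the
  coordinate \<open>v k\<close>. Once the definite description in \<open>dfdv\<close> is evaluated,
  its interpolation property is that of the tangent polynomials.\<close>

lemma dfdv_interpolates:
  fixes c :: "'p::finite \<Rightarrow> complex"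
  assumes "d \<ge> 2" and mc: "monic_centered d f" and "inj c" and crit: "range c = critical_points f"
  obtains D where "degree D < d - 1"
    "\<And>j. [:-c j, 1:] ^ order (c j) (pderiv f) dvd D - [:if j = k then 1 else 0:]"
    "\<And>z. dfdv d f c k z = poly D z"
proof -
  define m where "m j = order (c j) (pderiv f)" for j
  define x\<^sub>0 where "x\<^sub>0 = ((\<chi> j. c j) :: complex ^ 'p, coeff f 0)"
  define v where "v j = poly f (c j)" for j
  have f: "degree f = d" "lead_coeff f = 1" "coeff f (d - 1) = 0"
    using mc by (auto simp: monic_centered_def)
  have f'nz: "pderiv f \<noteq> 0" using f(1) \<open>d \<ge> 2\<close> by (simp add: pderiv_eq_0_iff)
  have m: "m j > 0" for j
  proof -
    have "c j \<in> critical_points f" using crit by blast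
    then show ?thesis using f'nz by (simp add: m_def order_gt_0_iff critical_points_def)
  qed
  have d: "d = Suc (sum m UNIV)" and fx: "f = crit_family m x\<^sub>0"
    using monic_eq_crit_family[of f c m] f \<open>d \<ge> 2\<close> \<open>inj c\<close> crit by (auto simp: m_def x\<^sub>0_def)
  have x0 [simp]: "fst x\<^sub>0 $ j = c j" for j by (simp add: x\<^sub>0_def)
  have nth0: "vec_nth (fst x\<^sub>0) = c" by auto
  have cm0: "crit_map m x\<^sub>0 = (\<chi> j. v j, 0)"
    using f(3) unfolding crit_map_def fx[symmetric] by (simp add: v_def d)
  obtain U V G where U: "open U" "x\<^sub>0 \<in> U" and V: "open V" "crit_map m x\<^sub>0 \<in> V"
    and hom: "homeomorphism U V (crit_map m) G" and bij: "bij (crit_map_deriv m x\<^sub>0)"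
    and G': "(G has_derivative inv (crit_map_deriv m x\<^sub>0)) (at (crit_map m x\<^sub>0))"
    using crit_map_local_inverse[of m x\<^sub>0, OF m] \<open>inj c\<close> nth0 by metis
  \<comment> \<open>The direction that moves the \<open>k\<close>-th critical value at unit speed
    and, to first order, keeps the others and the centering fixed.\<close>
  define h where "h = inv (crit_map_deriv m x\<^sub>0) (axis k 1, 0)"
  have h: "crit_map_deriv m x\<^sub>0 h = (axis k 1, 0)"
    unfolding h_def using bij by (simp add: bij_is_surj surj_f_inv_f)
  define D where "D = crit_family_deriv m x\<^sub>0 h"
  \<comment> \<open>The \<open>k\<close>-th coordinate line; the second component 0 keeps it over
    centered polynomials.\<close>
  define y where "y t = ((\<chi> i. (v(k := t)) i) :: complex ^ 'p, 0 :: complex)" for t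
  have y0: "y (v k) = crit_map m x\<^sub>0" by (simp add: y_def cm0)
  have Gy0: "G (y (v k)) = x\<^sub>0"
    using hom U unfolding y0 by (auto simp: homeomorphism_def)
  have y': "(y has_derivative (\<lambda>r. (axis k r, 0))) (at t)" for t
  proof -
    have "((\<lambda>t. \<chi> i. (v(k := t)) i) has_derivative (\<lambda>r. \<chi> i. if i = k then r else 0)) (at t)"
    proof (rule has_derivative_vec_lambda)
      show "((\<lambda>t. (v(k := t)) i) has_derivative (\<lambda>r. if i = k then r else 0)) (at t)" for i
        by (cases "i = k") auto
    qed
    from has_derivative_Pair[OF this has_derivative_const[of 0]] show ?thesis
      unfolding y_def axis_def .
  qed
  have inv_axis: "inv (crit_map_deriv m x\<^sub>0) (axis k r, 0) = (r *s fst h, r * snd h)" for r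
  proof -
    have "crit_map_deriv m x\<^sub>0 (r *s fst h, r * snd h) = (axis k r, 0)"
      by (simp add: crit_map_deriv_scale h) (simp add: axis_def vec_eq_iff)
    then show ?thesis using bij by (metis bij_is_inj inv_f_f)
  qed
  have Gy': "((\<lambda>t. G (y t)) has_derivative (\<lambda>r. (r *s fst h, r * snd h))) (at (v k))"
    using has_derivative_compose[OF y'[of "v k"], of G "inv (crit_map_deriv m x\<^sub>0)"] G' y0 inv_axis
    by simp
  have deriv_family: "((\<lambda>t. poly (crit_family m (G (y t))) z) has_field_derivative poly D z) (at (v k))" for z
  proof -
    have "((\<lambda>x. poly (crit_family m x) z) has_derivative (\<lambda>h. poly (crit_family_deriv m x\<^sub>0 h) z)) (at x\<^sub>0)"
      using has_derivative_poly_param[OF coeffs_have_derivative_crit_family degree_crit_family_le has_derivative_const]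
      by simp
    from has_derivative_compose[OF Gy', unfolded Gy0, OF this]
    show ?thesis
      unfolding has_field_derivative_def by (simp add: crit_family_deriv_scale D_def mult_commute_abs)
  qed
  have contGy: "isCont (\<lambda>t. G (y t)) (v k)"
    using Gy' by (rule has_derivative_continuous)

  \<comment> \<open>Small \<epsilon> must meet two demands: the discs around the \<open>c i\<close>
    are disjoint, and all parameters within \<epsilon> of \<open>x\<^sub>0\<close> in each of the
    \<open>p + 1\<close> coordinates lie in this ball, whence the bound
    \<open>r / (p + 1)\<close>.\<close>
  obtain r where r: "r > 0" "ball x\<^sub>0 r \<subseteq> U" using U openE by blast
  have small: "\<forall>\<^sub>F \<epsilon> in at_right 0. \<epsilon> < a" if "a > 0" for a :: real
    using that unfolding eventually_at_right_field by blast
  have "\<forall>\<^sub>F \<epsilon> in at_right 0. \<forall>i j. i \<noteq> j \<longrightarrow> 2 * \<epsilon> \<le> dist (c i) (c j)"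
  proof (intro eventually_all_finite)
    fix i j
    show "\<forall>\<^sub>F \<epsilon> in at_right 0. i \<noteq> j \<longrightarrow> 2 * \<epsilon> \<le> dist (c i) (c j)"
    proof (cases "i = j")
      case False
      then have "0 < dist (c i) (c j) / 2" using \<open>inj c\<close> by (simp add: inj_eq)
      from small[OF this] show ?thesis by eventually_elim simp
    qed auto
  qed
  moreover have "\<forall>\<^sub>F \<epsilon> in at_right 0. \<epsilon> < r / (real CARD('p) + 1)"
    using r by (intro small divide_pos_pos) auto
  moreover have "\<forall>\<^sub>F \<epsilon> in at_right (0::real). \<epsilon> > 0"
    by (simp add: eventually_at_right_less)
  ultimately have deriv: "\<forall>\<^sub>F \<epsilon> in at_right 0. \<forall>z.
      ((\<lambda>t. poly (poly_of_crit_val d f c \<epsilon> (v(k := t))) z) has_field_derivative poly D z) (at (v k))"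
  proof eventually_elim
    case (elim \<epsilon>)
    then have sep: "2 * \<epsilon> \<le> dist (c i) (c j)" if "i \<noteq> j" for i j using that by blast
    \<comment> \<open>All parameters from the stratum lie in \<open>U\<close>, where
      \<open>crit_map m\<close> is injective; hence the critical values determine the
      polynomial.\<close>
    have inj: "inj_on (crit_val c \<epsilon>) (stratum d f c \<epsilon>)"
    proof (rule inj_onI)
      have inU: "x \<in> U" if "\<And>j. dist (fst x $ j) (c j) < \<epsilon>" "dist (snd x) (coeff f 0) < \<epsilon>" for x
      proof -
        have "dist x x\<^sub>0 < r"
          by (rule dist_pair_vec_less) (use that elim in \<open>auto simp: x\<^sub>0_def intro: less_trans\<close>)
        then show ?thesis using r by (auto simp: dist_commute)
      qed
      fix g g' assume "g \<in> stratum d f c \<epsilon>" "g' \<in> stratum d f c \<epsilon>"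
        and eq: "crit_val c \<epsilon> g = crit_val c \<epsilon> g'"
      then obtain x x' where "g = crit_family m x" "x \<in> U" "crit_map m x = (\<chi> j. crit_val c \<epsilon> g j, 0)"
        "g' = crit_family m x'" "x' \<in> U" "crit_map m x' = (\<chi> j. crit_val c \<epsilon> g' j, 0)"
        using stratum_param[of d c f m, OF _ _ sep] \<open>d \<ge> 2\<close> inU m_def
        by (smt (verit, ccfv_threshold) Suc_1 Suc_leD)
      moreover from this have "x = x'"
        using eq hom by (metis homeomorphism_apply1)
      ultimately show "g = g'" by simp
    qed
    \<comment> \<open>For \<open>t\<close> near \<open>v k\<close> the polynomial with parameter
      \<open>G (y t)\<close> lies in the stratum and has the prescribed critical values. The filter
      \<open>nhds\<close> includes \<open>t = v k\<close> itself, as transferring the derivative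
      requires.\<close>
    have "\<forall>\<^sub>F t in nhds (v k). poly_of_crit_val d f c \<epsilon> (v(k := t)) = crit_family m (G (y t))"
    proof -
      have lim: "((\<lambda>t. G (y t)) \<longlongrightarrow> x\<^sub>0) (nhds (v k))"
        using contGy Gy0 tendsto_at_iff_tendsto_nhds[of "\<lambda>t. G (y t)" "v k"] by (simp add: isCont_def)
      have "isCont y (v k)" using y' by (rule has_derivative_continuous)
      then have "(y \<longlongrightarrow> crit_map m x\<^sub>0) (nhds (v k))"
        using y0 tendsto_at_iff_tendsto_nhds[of y "v k"] by (simp add: isCont_def)
      then have "\<forall>\<^sub>F t in nhds (v k). y t \<in> V" using V by (rule topological_tendstoD)
      moreover have "\<forall>\<^sub>F t in nhds (v k). \<forall>j. dist (fst (G (y t)) $ j) (c j) < \<epsilon>"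
      proof (rule eventually_all_finite)
        fix j
        have "((\<lambda>t. fst (G (y t)) $ j) \<longlongrightarrow> c j) (nhds (v k))"
          using tendsto_vec_nth[OF tendsto_fst[OF lim], of j] by simp
        then show "\<forall>\<^sub>F t in nhds (v k). dist (fst (G (y t)) $ j) (c j) < \<epsilon>"
          using elim by (intro tendstoD) auto
      qed
      moreover have "\<forall>\<^sub>F t in nhds (v k). \<forall>i\<in>{..d}. norm (coeff (crit_family m (G (y t))) i - coeff f i) < \<epsilon>"
      proof (rule eventually_ball_finite, simp, rule ballI)
        fix i
        have "isCont (\<lambda>x. coeff (crit_family m x) i) x\<^sub>0"
          using coeffs_have_derivative_crit_family[of m x\<^sub>0] unfolding coeffs_have_derivative_def
          by (blast intro: has_derivative_continuous)
        then have "((\<lambda>t. coeff (crit_family m (G (y t))) i) \<longlongrightarrow> coeff f i) (nhds (v k))"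
          unfolding fx by (rule isCont_tendsto_compose[OF _ lim])
        then show "\<forall>\<^sub>F t in nhds (v k). norm (coeff (crit_family m (G (y t))) i - coeff f i) < \<epsilon>"
          using elim by (auto dest!: tendstoD[of _ _ _ \<epsilon>] simp: dist_norm)
      qed
      ultimately show ?thesis
      proof eventually_elim
        case (elim t)
        let ?x = "G (y t)" and ?g = "crit_family m (G (y t))"
        have cm: "crit_map m ?x = y t"
          using elim(1) hom by (simp add: homeomorphism_apply2)
        have injx: "inj (vec_nth (fst ?x))"
        proof (rule injI, rule ccontr)
          fix i j assume eq: "fst ?x $ i = fst ?x $ j" and "i \<noteq> j"
          have "dist (c i) (c j) \<le> dist (fst ?x $ i) (c i) + dist (fst ?x $ j) (c j)"
            unfolding eq by (rule dist_triangle3)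
          also have "\<dots> < 2 * \<epsilon>" using elim(2) by (smt (verit))
          finally show False using sep[OF \<open>i \<noteq> j\<close>] by simp
        qed
        \<comment> \<open>Beyond index \<open>d\<close> both coefficients are 0, so only finitely
          many conditions had to hold eventually.\<close>
        have close: "norm (coeff ?g i - coeff f i) < \<epsilon>" for i
        proof (cases "i \<le> d")
          case False
          then show ?thesis
            using f(1) d \<open>0 < \<epsilon>\<close> by (simp add: coeff_eq_0 degree_crit_family)
        qed (use elim(3) in auto)
        have mem: "?g \<in> stratum d f c \<epsilon>"
          unfolding d by (rule crit_family_in_stratum)
            (use m injx cm close elim(2) in \<open>auto simp: m_def y_def\<close>)
        have "range (vec_nth (fst ?x)) = critical_points ?g"
          using poly_crit_poly_eq_0_iff[of m, OF m] by (auto simp: critical_points_def pderiv_crit_family)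
        then have "crit_pt c \<epsilon> ?g i = fst ?x $ i" for i
          using elim(2) by (intro crit_pt_eq sep) auto
        then have "crit_val c \<epsilon> ?g i = fst (crit_map m ?x) $ i" for i
          by (simp add: crit_val_def crit_map_def)
        then have "crit_val c \<epsilon> ?g = v(k := t)"
          unfolding cm by (auto simp: y_def)
        then show ?case
          unfolding poly_of_crit_val_def by (intro the_inv_into_f_eq inj mem)
      qed
    qed
    then have ev: "\<forall>\<^sub>F t in nhds (v k). poly (poly_of_crit_val d f c \<epsilon> (v(k := t))) z = poly (crit_family m (G (y t))) z" for z
      by eventually_elim simp
    show ?case
      using deriv_family DERIV_cong_ev[OF refl ev refl] by blast
  qed
  have dfdv: "dfdv d f c k z = poly D z" for z
    unfolding dfdv_def
  proof (rule the_equality)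
    show ev: "\<forall>\<^sub>F \<epsilon> in at_right 0. ((\<lambda>t. poly (poly_of_crit_val d f c \<epsilon> ((\<lambda>i. poly f (c i))(k := t))) z)
        has_field_derivative poly D z) (at (poly f (c k)))"
      using deriv unfolding v_def by eventually_elim blast
    fix D' assume "\<forall>\<^sub>F \<epsilon> in at_right 0. ((\<lambda>t. poly (poly_of_crit_val d f c \<epsilon> ((\<lambda>i. poly f (c i))(k := t))) z)
        has_field_derivative D') (at (poly f (c k)))"
    \<comment> \<open>Both derivative statements hold at a common \<epsilon>, since
      \<open>at_right 0\<close> is a proper filter.\<close>
    with ev have "\<forall>\<^sub>F \<epsilon> in at_right (0::real). D' = poly D z"
      by eventually_elim (rule DERIV_unique)
    then show "D' = poly D z" by simp
  qed
  have "degree D < d - 1"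
    using degree_crit_family_deriv_less[of m x\<^sub>0 h] h m d by (simp add: D_def sum_pos)
  moreover have "[:-c j, 1:] ^ order (c j) (pderiv f) dvd D - [:if j = k then 1 else 0:]" for j
  proof -
    have "poly D (c j) = fst (crit_map_deriv m x\<^sub>0 h) $ j"
      by (simp add: crit_map_deriv_def D_def)
    also have "\<dots> = (if j = k then 1 else 0)"
      unfolding h by (simp add: axis_def)
    finally show ?thesis
      using crit_family_deriv_interpolates[of m x\<^sub>0 j h, OF m] by (simp add: D_def m_def)
  qed
  ultimately show thesis using that dfdv by blast
qed

section \<open>The functional equation\<close>

lemma deriv_poly_funpow_Suc:
  "deriv (poly f ^^ Suc n) z = poly (pderiv f) ((poly f ^^ n) z) * deriv (poly f ^^ n) z"
proof -
  have "(poly f ^^ n) field_differentiable at z" for n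
  proof (induction n)
    case (Suc n)
    then show ?case
      unfolding funpow.simps
      by (intro field_differentiable_compose) (auto simp: field_differentiable_def intro: poly_DERIV)
  qed (simp add: field_differentiable_ident id_def)
  then have "deriv (poly f \<circ> (poly f ^^ n)) z = deriv (poly f) ((poly f ^^ n) z) * deriv (poly f ^^ n) z"
    by (intro deriv_chain) (auto simp: field_differentiable_def intro: poly_DERIV)
  then show ?thesis by (simp add: DERIV_imp_deriv[OF poly_DERIV])
qed

theorem proposition5:
  fixes d :: nat and f :: "complex poly" and c v :: "'p::finite \<Rightarrow> complex" and z x :: complex
  assumes "d \<ge> 2"
    and "monic_centered d f"
    and "inj c" and "range c = critical_points f"
    and "\<And>k. v k = poly f (c k)"
    and "\<And>n. deriv (poly f ^^ n) z \<noteq> 0"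
    and "x \<notin> range v"
    and "\<And>n. x \<noteq> (poly f ^^ n) z"
  shows "phi_series f z x - fps_X * T_fps f (phi_series f z) x =
         fps_const (1 / (z - x)) + (\<Sum>k\<in>UNIV. fps_const (1 / (v k - x)) * Phi_series d f c k z)"
proof -
  have "\<forall>k. \<exists>D. degree D < d - 1 \<and>
      (\<forall>j. [:-c j, 1:] ^ order (c j) (pderiv f) dvd D - [:if j = k then 1 else 0:]) \<and>
      (\<forall>z. dfdv d f c k z = poly D z)"
    using dfdv_interpolates[OF assms(1-4)] by metis
  then obtain D where D: "\<And>k. degree (D k) < d - 1"
    "\<And>j k. [:-c j, 1:] ^ order (c j) (pderiv f) dvd D k - [:if j = k then 1 else 0:]"
    "\<And>k z. dfdv d f c k z = poly (D k) z"
    by metis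
  show ?thesis
  proof (rule fps_ext)
    fix n
    show "fps_nth (phi_series f z x - fps_X * T_fps f (phi_series f z) x) n =
      fps_nth (fps_const (1 / (z - x)) + (\<Sum>k\<in>UNIV. fps_const (1 / (v k - x)) * Phi_series d f c k z)) n"
    proof (cases n)
      case 0
      then show ?thesis
        by (simp add: phi_series_def Phi_series_def fps_sum_nth id_def)
    next
      case (Suc l)
      \<comment> \<open>The coefficient of index \<open>l + 1\<close> involves \<open>T_op\<close>
        only through coefficient \<open>l\<close>, which is \<open>1 / q * (1 / (a - w))\<close> at
        a preimage \<open>w\<close> of \<open>x\<close>.\<close>
      define a where "a = (poly f ^^ l) z"
      define q where "q = deriv (poly f ^^ l) z"
      have ds: "deriv (poly f ^^ Suc l) z = poly (pderiv f) a * q"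
        by (simp only: deriv_poly_funpow_Suc a_def q_def)
      have nz: "q \<noteq> 0" "poly (pderiv f) a \<noteq> 0"
        using assms(6)[of l] assms(6)[of "Suc l"] unfolding ds q_def by auto
      \<comment> \<open>The orbit hypothesis at index \<open>l + 1\<close>; it also keeps
        \<open>a\<close> away from the preimages of \<open>x\<close>.\<close>
      have fa: "poly f a \<noteq> x" using assms(8)[of "Suc l"] by (simp add: a_def)
      have key: "1 / (poly (pderiv f) a * (poly f a - x)) -
           (\<Sum>w | poly f w = x. 1 / (a - w) / (poly (pderiv f) w)\<^sup>2) =
         (\<Sum>k\<in>UNIV. 1 / (poly f (c k) - x) * (poly (D k) a / poly (pderiv f) a))"
        using assms(2-5,7) D(1,2) fa nz(2)
        by (intro transfer_partial_fractions) (auto simp: monic_centered_def)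
      have "fps_nth (phi_series f z x - fps_X * T_fps f (phi_series f z) x) n =
        1 / (poly (pderiv f) a * q) * (1 / (poly f a - x)) -
          (\<Sum>w | poly f w = x. 1 / q * (1 / (a - w)) / (poly (pderiv f) w)\<^sup>2)"
        unfolding Suc phi_series_def T_fps_def T_op_def fps_sub_nth fps_X_mult_nth fps_nth_Abs_fps ds
        by (simp add: a_def q_def)
      also have "\<dots> = (1 / (poly (pderiv f) a * (poly f a - x)) -
           (\<Sum>w | poly f w = x. 1 / (a - w) / (poly (pderiv f) w)\<^sup>2)) / q"
        by (simp add: diff_divide_distrib sum_divide_distrib mult_ac)
      also have "\<dots> = (\<Sum>k\<in>UNIV. 1 / (v k - x) * (poly (D k) a / (poly (pderiv f) a * q)))"
        unfolding key by (simp add: sum_divide_distrib assms(5) mult_ac)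
      also have "\<dots> = fps_nth (fps_const (1 / (z - x)) +
          (\<Sum>k\<in>UNIV. fps_const (1 / (v k - x)) * Phi_series d f c k z)) n"
        unfolding Suc Phi_series_def fps_add_nth fps_sum_nth fps_mult_left_const_nth fps_X_mult_nth
          fps_nth_Abs_fps D(3)
        using ds by (simp add: a_def)
      finally show ?thesis .
    qed
  qed
qed

end
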